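(* Let $\mathcal{T}$ be a TBox, let $\Sigma\subseteq\mathrm{sig}(\mathcal{T})$ be a signature, and let $\chi_{\mathsf c}=\langle\theta^{\mathsf c},\mathcal{A}_0^{\mathsf c},\mathcal{A}_r^{\mathsf c}\rangle$ be the module setting for $\mathcal{T}$ and $\Sigma$ defined in the context. Then $\mathcal{M}^{\chi_{\mathsf c}}\equiv^{\mathsf c}_\Sigma\mathcal{T}$, i.e. $\mathcal{M}^{\chi_{\mathsf c}}$ is $\Sigma$-classification inseparable from $\mathcal{T}$: for each $\varphi$ of the form $A(\mathbf{x})\to B(\mathbf{x})$ with $A\in\Sigma$ and $B\in\mathrm{sig}(\mathcal{T}\cup\mathcal{M}^{\chi_{\mathsf c}})$, $\mathcal{M}^{\chi_{\mathsf c}}\models\varphi$ if and only if $\mathcal{T}\models\varphi$.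
   Context: Rules and TBoxes. Standard first-order logic is used. A signature is a set of predicates; $\mathrm{sig}(F)$ is the signature of a set of formulas $F$; the nullary falsehood predicate $\bot$ is assumed to belong to every signature. A rule is a function-free sentence $\forall\mathbf{x}.[\varphi(\mathbf{x})\to\exists\mathbf{y}.[\bigvee_{i=1}^n\psi_i(\mathbf{x},\mathbf{y})]]$ with the body $\varphi$ and the $\psi_i$ conjunctions of distinct atoms ($n\ge 0$; for $n=0$ the head is the empty disjunction, i.e. $\bot$). Rules are safe (all universally quantified variables in the head occur in the body), and w.l.o.g. the truth symbol $\top$ does not occur in rule heads and $\bot$ does not occur in rule bodies. Universal quantifiers are usually omitted. A TBox is a finite set of rules; TBoxes mentioning equality are extended with its standard axiomatisation. A fact is a function-free ground atom; an ABox is a finite set of facts; a $\Sigma$-ABox is an ABox over the predicates of $\Sigma$. Standing assumptions: $\mathcal{T}$ contains no constants and rules in $\mathcal{T}$ do not share existentially quantified variables. In $A(\mathbf{x})\to B(\mathbf{x})$, $\mathbf{x}$ is a tuple of (w.l.o.g. pairwise distinct) universally quantified variables. Datalog. A rule is datalog if its head has at most one atom and all variables are universally quantified; a datalog program $\mathcal{P}$ is a set of datalog rules. A fact $\gamma$ is a consequence of a datalog rule $\bigwedge_{i=1}^n\gamma_i'\to\delta$ and facts $\gamma_1,\dots,\gamma_n$ if $\gamma=\delta\sigma$ with $\sigma$ a most general unifier of $\gamma_i,\gamma_i'$ for each $1\le i\le n$. A proof of $\gamma$ in $\mathcal{P}\cup\mathcal{A}$ ($\mathcal{A}$ an ABox)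 is a pair $(T,\lambda)$ with $T$ a tree and $\lambda$ mapping nodes of $T$ to facts and edges of $T$ to rules of $\mathcal{P}$, such that for each node $v$: (1) $\lambda(v)=\gamma$ if $v$ is the root; (2) $\lambda(v)\in\mathcal{A}$ if $v$ is a leaf; (3) if $v$ has children $w_1,\dots,w_n$, then all edges from $v$ to the $w_i$ are labelled by the same rule $r$ and $\lambda(v)$ is a consequence of $r$ and $\lambda(w_1),\dots,\lambda(w_n)$. The support of $\gamma$ is the set of rules occurring in some proof of $\gamma$ in $\mathcal{P}\cup\mathcal{A}$. Module settings. A module setting for $\mathcal{T}$ and $\Sigma$ is a tuple $\chi=\langle\theta,\mathcal{A}_0,\mathcal{A}_r\rangle$ with $\theta$ a substitution from the existentially quantified variables of $\mathcal{T}$ to constants, $\mathcal{A}_0$ a $\Sigma$-ABox, $\mathcal{A}_r$ a $\mathrm{sig}(\mathcal{T})$-ABox, and such that no constant in $\chi$ occurs in $\mathcal{T}$. The program $\mathcal{P}^\chi$ is the smallest datalog program containing, for each rule $\varphi(\mathbf{x})\to\exists\mathbf{y}.[\bigvee_{i=1}^n\psi_i(\mathbf{x},\mathbf{y})]$ in $\mathcal{T}$, the following corresponding datalog rules: $\varphi\to\bot$ if $n=0$, and $\varphi\to\gamma\theta$ for each $1\le i\le n$ and each atom $\gamma$ in $\psi_i$. The support of $\chi$ is the set of rules of $\mathcal{P}^\chi$ that support a fact from $\mathcal{A}_r$ in $\mathcal{P}^\chi\cup\mathcal{A}_0$. The module $\mathcal{M}^\chi$ is the set of rules in $\mathcal{T}$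 that have a corresponding datalog rule in the support of $\chi$. The setting $\chi_{\mathsf c}$. Let $c_y$ be a fresh constant for each existentially quantified variable $y$ in $\mathcal{T}$, and let $c_A^1,\dots,c_A^n$ be also fresh constants for each $A\in\Sigma$ of arity $n$. Then $\theta^{\mathsf c}=\{y\mapsto c_y\mid y\text{ existentially quantified in }\mathcal{T}\}$; $\mathcal{A}_0^{\mathsf c}=\{A(c_A^1,\dots,c_A^n)\mid A\ n\text{-ary predicate in }\Sigma\}$; and $\mathcal{A}_r^{\mathsf c}$ consists of all facts $B(c_A^1,\dots,c_A^n)$ such that $A\ne B$ are $n$-ary predicates, $A\in\Sigma$ and $B\in\mathrm{sig}(\mathcal{T})$.
   Formalization: Falsehood is allowed as B for every arity n, so ⊥ itself is put into A_r^c (and A(x)→⊥ is covered), and ⊤ is allowed as a leaf of any proof; with ⊥ strictly nullary, T={A(x)→⊥, B(x)→C(x)}, Σ={A,⊥} refutes the claim. *)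

theory Defs
  imports Main
begin

text \<open>
  A predicate symbol consists of a name and an arity. Falsehood is a nullary predicate; the truth
  symbol is a nullary logical symbol and is not counted as a predicate of a signature. Equality is
  an ordinary binary predicate: a TBox that mentions it is understood to contain the rules
  axiomatising it.
\<close>

datatype 'p pred = Bot | Top | Sym 'p nat

primrec arity :: "'p pred \<Rightarrow> nat" where
  "arity Bot = 0"
| "arity Top = 0"
| "arity (Sym p n) = n"

datatype ('v, 'c) trm = Var 'v | Const 'c

datatype ('p, 'v, 'c) atom = Atom (pred_of: "'p pred") (args: "('v, 'c) trm list")

primrec trm_vars :: "('v, 'c) trm \<Rightarrow> 'v set" where
  "trm_vars (Var x) = {x}"
| "trm_vars (Const c) = {}"

primrec trm_constants :: "('v, 'c) trm \<Rightarrow> 'c set" where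
  "trm_constants (Var x) = {}"
| "trm_constants (Const c) = {c}"

definition atom_vars :: "('p, 'v, 'c) atom \<Rightarrow> 'v set" where
  "atom_vars a = (\<Union>t\<in>set (args a). trm_vars t)"

definition atom_constants :: "('p, 'v, 'c) atom \<Rightarrow> 'c set" where
  "atom_constants a = (\<Union>t\<in>set (args a). trm_constants t)"

definition wf_atom :: "('p, 'v, 'c) atom \<Rightarrow> bool" where
  "wf_atom a \<longleftrightarrow> length (args a) = arity (pred_of a)"

definition is_fact :: "('p, 'v, 'c) atom \<Rightarrow> bool" where
  "is_fact a \<longleftrightarrow> wf_atom a \<and> atom_vars a = {}"

abbreviation bot_atom :: "('p, 'v, 'c) atom" where
  "bot_atom \<equiv> Atom Bot []"

abbreviation top_atom :: "('p, 'v, 'c) atom" where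
  "top_atom \<equiv> Atom Top []"

definition is_abox :: "'p pred set \<Rightarrow> ('p, 'v, 'c) atom set \<Rightarrow> bool" where
  "is_abox S A \<longleftrightarrow> finite A \<and> (\<forall>a\<in>A. is_fact a \<and> pred_of a \<in> S)"


section \<open>Rules and TBoxes\<close>

text \<open>
  \<open>Rule \<phi> Y [\<psi>\<^sub>1, \<dots>, \<psi>\<^sub>n]\<close> is the sentence
  \<open>\<forall>x. \<phi> \<longrightarrow> (\<exists>y. \<psi>\<^sub>1 \<or> \<dots> \<or> \<psi>\<^sub>n)\<close>, where \<open>\<phi>\<close> and the \<open>\<psi>\<^sub>i\<close> are lists of conjuncts, \<open>Y\<close> is the set
  of the variables in \<open>y\<close>, and all other variables are universally quantified.
\<close>

datatype ('p, 'v, 'c) rule =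
  Rule (body: "('p, 'v, 'c) atom list") (exs: "'v set") (heads: "('p, 'v, 'c) atom list list")

definition head_atoms :: "('p, 'v, 'c) rule \<Rightarrow> ('p, 'v, 'c) atom set" where
  "head_atoms r = (\<Union>\<psi>\<in>set (heads r). set \<psi>)"

definition rule_atoms :: "('p, 'v, 'c) rule \<Rightarrow> ('p, 'v, 'c) atom set" where
  "rule_atoms r = set (body r) \<union> head_atoms r"

definition body_vars :: "('p, 'v, 'c) rule \<Rightarrow> 'v set" where
  "body_vars r = (\<Union>a\<in>set (body r). atom_vars a)"

definition head_vars :: "('p, 'v, 'c) rule \<Rightarrow> 'v set" where
  "head_vars r = (\<Union>a\<in>head_atoms r. atom_vars a)"

text \<open>
  The empty conjunction is the truth symbol, so conjunctions are nonempty lists. The inclusion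
  of \<open>head_vars\<close> is safety.
\<close>

definition wf_rule :: "('p, 'v, 'c) rule \<Rightarrow> bool" where
  "wf_rule r \<longleftrightarrow>
     (\<forall>a\<in>rule_atoms r. wf_atom a) \<and>
     body r \<noteq> [] \<and> distinct (body r) \<and>
     (\<forall>\<psi>\<in>set (heads r). \<psi> \<noteq> [] \<and> distinct \<psi>) \<and>
     (\<forall>a\<in>set (body r). pred_of a \<noteq> Bot) \<and>
     (\<forall>a\<in>head_atoms r. pred_of a \<noteq> Top) \<and>
     finite (exs r) \<and> exs r \<inter> body_vars r = {} \<and>
     head_vars r \<subseteq> body_vars r \<union> exs r"

definition is_tbox :: "('p, 'v, 'c) rule set \<Rightarrow> bool" where
  "is_tbox T \<longleftrightarrow> finite T \<and> (\<forall>r\<in>T. wf_rule r)"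

definition constants_of :: "('p, 'v, 'c) rule set \<Rightarrow> 'c set" where
  "constants_of T = (\<Union>r\<in>T. \<Union>a\<in>rule_atoms r. atom_constants a)"

definition exvars :: "('p, 'v, 'c) rule set \<Rightarrow> 'v set" where
  "exvars T = (\<Union>r\<in>T. exs r)"

definition no_shared_exvars :: "('p, 'v, 'c) rule set \<Rightarrow> bool" where
  "no_shared_exvars T \<longleftrightarrow> (\<forall>r\<in>T. \<forall>r'\<in>T. r \<noteq> r' \<longrightarrow> exs r \<inter> exs r' = {})"

text \<open>Falsehood belongs to every signature.\<close>

definition sig :: "('p, 'v, 'c) rule set \<Rightarrow> 'p pred set" where
  "sig T = insert Bot ((\<Union>r\<in>T. pred_of ` rule_atoms r) - {Top})"


section \<open>First-order semantics\<close>

text \<open>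
  Domains are nonempty subsets of the type \<open>'d\<close>. For an infinite type \<open>'d\<close> this gives standard
  first-order entailment from finite sets of function-free sentences (downward
  Loewenheim-Skolem).
\<close>

record ('p, 'c, 'd) interp =
  domain :: "'d set"
  const_interp :: "'c \<Rightarrow> 'd"
  pred_interp :: "'p pred \<Rightarrow> 'd list set"

definition is_interp :: "('p, 'c, 'd) interp \<Rightarrow> bool" where
  "is_interp I \<longleftrightarrow> domain I \<noteq> {} \<and> range (const_interp I) \<subseteq> domain I"

primrec trm_val :: "('p, 'c, 'd) interp \<Rightarrow> ('v \<Rightarrow> 'd) \<Rightarrow> ('v, 'c) trm \<Rightarrow> 'd" where
  "trm_val I \<nu> (Var x) = \<nu> x"
| "trm_val I \<nu> (Const c) = const_interp I c"

primrec holds :: "('p, 'c, 'd) interp \<Rightarrow> ('v \<Rightarrow> 'd) \<Rightarrow> ('p, 'v, 'c) atom \<Rightarrow> bool" where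
  "holds I \<nu> (Atom p ts) =
     (case p of
        Bot \<Rightarrow> False
      | Top \<Rightarrow> True
      | Sym _ _ \<Rightarrow> map (trm_val I \<nu>) ts \<in> pred_interp I p)"

definition satisfies :: "('p, 'c, 'd) interp \<Rightarrow> ('p, 'v, 'c) rule \<Rightarrow> bool" where
  "satisfies I r \<longleftrightarrow>
     (\<forall>\<nu>. range \<nu> \<subseteq> domain I \<longrightarrow> (\<forall>a\<in>set (body r). holds I \<nu> a) \<longrightarrow>
        (\<exists>\<mu>. range \<mu> \<subseteq> domain I \<and> (\<forall>x. x \<notin> exs r \<longrightarrow> \<mu> x = \<nu> x) \<and>
             (\<exists>\<psi>\<in>set (heads r). \<forall>a\<in>set \<psi>. holds I \<mu> a)))"

definition entails :: "'d itself \<Rightarrow> ('p, 'v, 'c) rule set \<Rightarrow> ('p, 'v, 'c) rule \<Rightarrow> bool" where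
  "entails _ T \<phi> \<longleftrightarrow>
     (\<forall>I :: ('p, 'c, 'd) interp. is_interp I \<longrightarrow> (\<forall>r\<in>T. satisfies I r) \<longrightarrow> satisfies I \<phi>)"


section \<open>Datalog\<close>

text \<open>
  A datalog rule is a pair of its body and its head; the empty head is \<open>bot_atom\<close>.
\<close>

type_synonym ('p, 'v, 'c) datalog_rule = "('p, 'v, 'c) atom list \<times> ('p, 'v, 'c) atom"

primrec subst_trm :: "('v \<Rightarrow> ('v, 'c) trm) \<Rightarrow> ('v, 'c) trm \<Rightarrow> ('v, 'c) trm" where
  "subst_trm \<sigma> (Var x) = \<sigma> x"
| "subst_trm \<sigma> (Const c) = Const c"

definition subst_atom ::
  "('v \<Rightarrow> ('v, 'c) trm) \<Rightarrow> ('p, 'v, 'c) atom \<Rightarrow> ('p, 'v, 'c) atom" where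
  "subst_atom \<sigma> a = Atom (pred_of a) (map (subst_trm \<sigma>) (args a))"

definition is_unifier ::
  "('v \<Rightarrow> ('v, 'c) trm) \<Rightarrow> (('p, 'v, 'c) atom \<times> ('p, 'v, 'c) atom) set \<Rightarrow> bool" where
  "is_unifier \<sigma> E \<longleftrightarrow> (\<forall>(a, b)\<in>E. subst_atom \<sigma> a = subst_atom \<sigma> b)"

definition is_mgu ::
  "('v \<Rightarrow> ('v, 'c) trm) \<Rightarrow> (('p, 'v, 'c) atom \<times> ('p, 'v, 'c) atom) set \<Rightarrow> bool" where
  "is_mgu \<sigma> E \<longleftrightarrow>
     is_unifier \<sigma> E \<and> (\<forall>\<tau>. is_unifier \<tau> E \<longrightarrow> (\<exists>\<rho>. \<tau> = subst_trm \<rho> \<circ> \<sigma>))"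

definition consequence ::
  "('p, 'v, 'c) atom \<Rightarrow> ('p, 'v, 'c) datalog_rule \<Rightarrow> ('p, 'v, 'c) atom list \<Rightarrow> bool" where
  "consequence \<gamma> r \<gamma>s \<longleftrightarrow>
     is_fact \<gamma> \<and> length \<gamma>s = length (fst r) \<and>
     (\<exists>\<sigma>. is_mgu \<sigma> (set (zip \<gamma>s (fst r))) \<and> \<gamma> = subst_atom \<sigma> (snd r))"

text \<open>
  Proof trees. All edges below an inner node carry the same rule, which is stored at the node.
  The truth symbol, which may occur in rule bodies, is available as a leaf in every proof.
\<close>

datatype ('p, 'v, 'c) proof_tree =
  Leaf "('p, 'v, 'c) atom"
| Node "('p, 'v, 'c) atom" "('p, 'v, 'c) datalog_rule" "('p, 'v, 'c) proof_tree list"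

fun root_fact :: "('p, 'v, 'c) proof_tree \<Rightarrow> ('p, 'v, 'c) atom" where
  "root_fact (Leaf \<gamma>) = \<gamma>"
| "root_fact (Node \<gamma> r ts) = \<gamma>"

fun tree_rules :: "('p, 'v, 'c) proof_tree \<Rightarrow> ('p, 'v, 'c) datalog_rule set" where
  "tree_rules (Leaf \<gamma>) = {}"
| "tree_rules (Node \<gamma> r ts) = insert r (\<Union>t\<in>set ts. tree_rules t)"

fun valid_tree ::
  "('p, 'v, 'c) datalog_rule set \<Rightarrow> ('p, 'v, 'c) atom set \<Rightarrow> ('p, 'v, 'c) proof_tree \<Rightarrow> bool" where
  "valid_tree P A (Leaf \<gamma>) \<longleftrightarrow> \<gamma> \<in> A \<or> \<gamma> = top_atom"
| "valid_tree P A (Node \<gamma> r ts) \<longleftrightarrow>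
     ts \<noteq> [] \<and> r \<in> P \<and> consequence \<gamma> r (map root_fact ts) \<and> (\<forall>t\<in>set ts. valid_tree P A t)"

definition is_proof ::
  "('p, 'v, 'c) datalog_rule set \<Rightarrow> ('p, 'v, 'c) atom set \<Rightarrow> ('p, 'v, 'c) atom \<Rightarrow>
   ('p, 'v, 'c) proof_tree \<Rightarrow> bool" where
  "is_proof P A \<gamma> t \<longleftrightarrow> valid_tree P A t \<and> root_fact t = \<gamma>"

definition fact_support ::
  "('p, 'v, 'c) datalog_rule set \<Rightarrow> ('p, 'v, 'c) atom set \<Rightarrow> ('p, 'v, 'c) atom \<Rightarrow>
   ('p, 'v, 'c) datalog_rule set" where
  "fact_support P A \<gamma> = (\<Union>t\<in>{t. is_proof P A \<gamma> t}. tree_rules t)"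


section \<open>Module settings and modules\<close>

record ('p, 'v, 'c) setting =
  theta :: "'v \<Rightarrow> 'c option"
  initial_facts :: "('p, 'v, 'c) atom set"
  relevant_facts :: "('p, 'v, 'c) atom set"

definition setting_constants :: "('p, 'v, 'c) setting \<Rightarrow> 'c set" where
  "setting_constants \<chi> =
     ran (theta \<chi>) \<union> (\<Union>a\<in>initial_facts \<chi> \<union> relevant_facts \<chi>. atom_constants a)"

definition module_setting ::
  "('p, 'v, 'c) rule set \<Rightarrow> 'p pred set \<Rightarrow> ('p, 'v, 'c) setting \<Rightarrow> bool" where
  "module_setting T \<Sigma> \<chi> \<longleftrightarrow>
     dom (theta \<chi>) = exvars T \<and> is_abox \<Sigma> (initial_facts \<chi>) \<and>
     is_abox (sig T) (relevant_facts \<chi>) \<and> setting_constants \<chi> \<inter> constants_of T = {}"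

definition subst_of :: "('v \<Rightarrow> 'c option) \<Rightarrow> 'v \<Rightarrow> ('v, 'c) trm" where
  "subst_of \<theta> x = (case \<theta> x of None \<Rightarrow> Var x | Some c \<Rightarrow> Const c)"

text \<open>
  The substitution is restricted to the existential variables of the rule at hand, because a
  variable may be existentially quantified in one rule and universally quantified in another.
\<close>

definition corresponding ::
  "('v \<Rightarrow> 'c option) \<Rightarrow> ('p, 'v, 'c) rule \<Rightarrow> ('p, 'v, 'c) datalog_rule set" where
  "corresponding \<theta> r =
     (if heads r = [] then {(body r, bot_atom)}
      else {(body r, subst_atom (subst_of (\<theta> |` exs r)) \<gamma>) | \<gamma>. \<gamma> \<in> head_atoms r})"

definition program ::
  "('p, 'v, 'c) rule set \<Rightarrow> ('p, 'v, 'c) setting \<Rightarrow> ('p, 'v, 'c) datalog_rule set" where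
  "program T \<chi> = (\<Union>r\<in>T. corresponding (theta \<chi>) r)"

definition support ::
  "('p, 'v, 'c) rule set \<Rightarrow> ('p, 'v, 'c) setting \<Rightarrow> ('p, 'v, 'c) datalog_rule set" where
  "support T \<chi> =
     (\<Union>\<gamma>\<in>relevant_facts \<chi>. fact_support (program T \<chi>) (initial_facts \<chi>) \<gamma>)"

definition module_of ::
  "('p, 'v, 'c) rule set \<Rightarrow> ('p, 'v, 'c) setting \<Rightarrow> ('p, 'v, 'c) rule set" where
  "module_of T \<chi> = {r \<in> T. corresponding (theta \<chi>) r \<inter> support T \<chi> \<noteq> {}}"


section \<open>Classification inseparability\<close>

text \<open>
  In an expression \<open>B(t\<^sub>1, \<dots>, t\<^sub>n)\<close> used for classification, falsehood is admitted as \<open>B\<close> for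
  every \<open>n\<close>, and \<open>\<bottom>(t\<^sub>1, \<dots>, t\<^sub>n)\<close> stands for \<open>\<bottom>\<close>; so \<open>A(x) \<longrightarrow> \<bottom>\<close> is among the rules considered.
  Without this convention, for the TBox of the two rules \<open>A(x) \<longrightarrow> \<bottom>\<close> and \<open>B(x) \<longrightarrow> C(x)\<close> and the
  signature \<open>{A, \<bottom>}\<close>, the module for the setting \<open>chi_c\<close> below would be empty although the TBox
  entails \<open>A(x) \<longrightarrow> B(x)\<close>.
\<close>

definition has_arity :: "'p pred \<Rightarrow> nat \<Rightarrow> bool" where
  "has_arity p n \<longleftrightarrow> p = Bot \<or> arity p = n"

definition apply_pred :: "'p pred \<Rightarrow> ('v, 'c) trm list \<Rightarrow> ('p, 'v, 'c) atom" where
  "apply_pred p ts = (if p = Bot then bot_atom else Atom p ts)"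

definition subsumption :: "'p pred \<Rightarrow> 'p pred \<Rightarrow> 'v list \<Rightarrow> ('p, 'v, 'c) rule" where
  "subsumption A B xs =
     Rule [apply_pred A (map Var xs)] {} [[apply_pred B (map Var xs)]]"

definition class_inseparable ::
  "'d itself \<Rightarrow> 'p pred set \<Rightarrow> ('p, 'v, 'c) rule set \<Rightarrow> ('p, 'v, 'c) rule set \<Rightarrow> bool" where
  "class_inseparable d \<Sigma> M T \<longleftrightarrow>
     (\<forall>A\<in>\<Sigma>. \<forall>B\<in>sig (T \<union> M). \<forall>xs.
        distinct xs \<longrightarrow> has_arity A (length xs) \<longrightarrow> has_arity B (length xs) \<longrightarrow>
        (entails d M (subsumption A B xs) \<longleftrightarrow> entails d T (subsumption A B xs)))"

text \<open>
  \<open>cv y\<close> is the constant chosen for the existential variable \<open>y\<close>, and \<open>cp A i\<close>, for \<open>i\<close> from 1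
  to the arity of \<open>A\<close>, is the \<open>i\<close>-th constant chosen for the predicate \<open>A\<close>.
\<close>

definition fresh_constants ::
  "('p, 'v, 'c) rule set \<Rightarrow> 'p pred set \<Rightarrow> ('v \<Rightarrow> 'c) \<Rightarrow> ('p pred \<Rightarrow> nat \<Rightarrow> 'c) \<Rightarrow> bool" where
  "fresh_constants T \<Sigma> cv cp \<longleftrightarrow>
     (let I = {(A, i). A \<in> \<Sigma> \<and> 1 \<le> i \<and> i \<le> arity A} in
        inj_on cv (exvars T) \<and> inj_on (\<lambda>(A, i). cp A i) I \<and>
        cv ` exvars T \<inter> (\<lambda>(A, i). cp A i) ` I = {} \<and>
        (cv ` exvars T \<union> (\<lambda>(A, i). cp A i) ` I) \<inter> constants_of T = {})"

definition pred_constants ::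
  "('p pred \<Rightarrow> nat \<Rightarrow> 'c) \<Rightarrow> 'p pred \<Rightarrow> ('v, 'c) trm list" where
  "pred_constants cp A = map (\<lambda>i. Const (cp A i)) [1..<Suc (arity A)]"

definition chi_c ::
  "('p, 'v, 'c) rule set \<Rightarrow> 'p pred set \<Rightarrow> ('v \<Rightarrow> 'c) \<Rightarrow> ('p pred \<Rightarrow> nat \<Rightarrow> 'c) \<Rightarrow>
   ('p, 'v, 'c) setting" where
  "chi_c T \<Sigma> cv cp =
     \<lparr> theta = (\<lambda>y. if y \<in> exvars T then Some (cv y) else None),
       initial_facts = {Atom A (pred_constants cp A) | A. A \<in> \<Sigma>},
       relevant_facts = {apply_pred B (pred_constants cp A) | A B.
          A \<in> \<Sigma> \<and> B \<in> sig T \<and> A \<noteq> B \<and> has_arity B (arity A)} \<rparr>"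

lemma finite_sig: "is_tbox T \<Longrightarrow> finite (sig T)"
  by (auto simp: is_tbox_def sig_def rule_atoms_def head_atoms_def)

lemma pred_constants_props:
  "length (pred_constants cp A) = arity A"
  "t \<in> set (pred_constants cp A) \<Longrightarrow> trm_vars t = {}"
  "(\<Union>t\<in>set (pred_constants cp A). trm_constants t) = cp A ` {1..arity A}"
  by (auto simp: pred_constants_def)

lemma module_setting_chi_c:
  fixes T :: "('p, 'v, 'c) rule set"
  assumes T: "is_tbox T" and \<Sigma>: "\<Sigma> \<subseteq> sig T" and fresh: "fresh_constants T \<Sigma> cv cp"
  shows "module_setting T \<Sigma> (chi_c T \<Sigma> cv cp)"
proof -
  let ?\<chi> = "chi_c T \<Sigma> cv cp"
  have fin: "finite (sig T)" "finite \<Sigma>"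
    using finite_sig[OF T] \<Sigma> finite_subset by auto
  have "initial_facts ?\<chi> = (\<lambda>A. Atom A (pred_constants cp A)) ` \<Sigma>"
    by (auto simp: chi_c_def)
  then have A0: "is_abox \<Sigma> (initial_facts ?\<chi>)"
    using fin by (auto simp: is_abox_def is_fact_def wf_atom_def atom_vars_def pred_constants_props)
  have "relevant_facts ?\<chi> \<subseteq> (\<lambda>(A, B). apply_pred B (pred_constants cp A)) ` (\<Sigma> \<times> sig T)"
    by (auto simp: chi_c_def)
  then have "finite (relevant_facts ?\<chi>)"
    using fin by (meson finite_SigmaI finite_imageI finite_subset)
  then have Ar: "is_abox (sig T) (relevant_facts ?\<chi>)"
    by (auto simp: is_abox_def is_fact_def wf_atom_def atom_vars_def pred_constants_props
        chi_c_def apply_pred_def has_arity_def)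
  have th: "dom (theta ?\<chi>) = exvars T" "ran (theta ?\<chi>) = cv ` exvars T"
    by (auto simp: chi_c_def dom_def ran_def split: if_splits)
  have consts_eq: "atom_constants (Atom p (pred_constants cp A) :: ('p, 'v, 'c) atom) = cp A ` {1..arity A}"
    "atom_constants (bot_atom :: ('p, 'v, 'c) atom) = {}" for p :: "'p pred" and A
    by (simp_all only: atom_constants_def pred_constants_props atom.sel list.set UN_empty)
  have "atom_constants a \<subseteq> (\<Union>A\<in>\<Sigma>. cp A ` {1..arity A})"
    if "a \<in> initial_facts ?\<chi> \<union> relevant_facts ?\<chi>" for a
  proof -
    from that obtain A B where "A \<in> \<Sigma>"
      and "a = Atom A (pred_constants cp A) \<or> a = apply_pred B (pred_constants cp A)"
      unfolding chi_c_def by auto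
    then have "A \<in> \<Sigma>" "atom_constants a \<subseteq> cp A ` {1..arity A}"
      by (auto simp only: apply_pred_def consts_eq split: if_splits)
    then show ?thesis
      by blast
  qed
  then have "(\<Union>a\<in>initial_facts ?\<chi> \<union> relevant_facts ?\<chi>. atom_constants a) \<subseteq>
        (\<Union>A\<in>\<Sigma>. cp A ` {1..arity A})"
    by (rule UN_least)
  also have "\<dots> = (\<lambda>(A, i). cp A i) ` {(A, i). A \<in> \<Sigma> \<and> 1 \<le> i \<and> i \<le> arity A}"
    by auto
  finally have "setting_constants ?\<chi> \<subseteq> cv ` exvars T \<union>
      (\<lambda>(A, i). cp A i) ` {(A, i). A \<in> \<Sigma> \<and> 1 \<le> i \<and> i \<le> arity A}"
    unfolding setting_constants_def th by (rule Un_mono[OF subset_refl])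
  moreover have "(cv ` exvars T \<union> (\<lambda>(A, i). cp A i) ` {(A, i). A \<in> \<Sigma> \<and> 1 \<le> i \<and> i \<le> arity A})
      \<inter> constants_of T = {}"
    using fresh unfolding fresh_constants_def Let_def by (elim conjE)
  ultimately have "setting_constants ?\<chi> \<inter> constants_of T = {}"
    by (meson disjoint_iff subsetD)
  with A0 Ar th show ?thesis
    by (auto simp: module_setting_def)
qed

end

theory Submission
  imports Defs
begin

text \<open>
  Let \<open>I\<close> be a model of the module with \<open>A(d)\<close> true and \<open>B(d)\<close> false. Elements of a new
  interpretation are pairs of an element of \<open>I\<close> and a constant of the datalog program. A tuple of
  pairs is in a predicate if the tuple of constants is derivable by datalog and, provided that this
  derivable fact can be used in a proof of a relevant fact, the tuple of elements is in the predicate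
  in \<open>I\<close>. Rules outside the module only derive facts that are never used for a relevant fact, so they
  hold because such facts are all true; rules of the module hold because they hold in \<open>I\<close>. The fact
  \<open>B(c\<^sub>A)\<close> is relevant, so the new interpretation is a model of the TBox that still refutes
  \<open>A(x) \<longrightarrow> B(x)\<close>.
\<close>

section \<open>Datalog proofs\<close>

definition derivable ::
  "('p, 'v, 'c) datalog_rule set \<Rightarrow> ('p, 'v, 'c) atom set \<Rightarrow> ('p, 'v, 'c) atom \<Rightarrow> bool" where
  "derivable P A \<gamma> \<longleftrightarrow> (\<exists>t. is_proof P A \<gamma> t)"

lemma derivable_fact: "\<gamma> \<in> A \<Longrightarrow> derivable P A \<gamma>"
  unfolding derivable_def is_proof_def by (rule exI[of _ "Leaf \<gamma>"]) simp

lemma derivable_top: "derivable P A top_atom"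
  unfolding derivable_def is_proof_def by (rule exI[of _ "Leaf top_atom"]) simp

lemma is_proof_Node:
  assumes "\<gamma>s \<noteq> []" "\<rho> \<in> P" "consequence \<gamma> \<rho> \<gamma>s" "\<And>\<delta>. \<delta> \<in> set \<gamma>s \<Longrightarrow> is_proof P A \<delta> (t \<delta>)"
  shows "is_proof P A \<gamma> (Node \<gamma> \<rho> (map t \<gamma>s))"
proof -
  have "map (root_fact \<circ> t) \<gamma>s = \<gamma>s"
    using assms(4) by (simp add: is_proof_def map_idI)
  with assms show ?thesis
    by (simp add: is_proof_def)
qed

text \<open>Apart from underivable targets, these are the facts occurring in proofs of facts of
  \<open>R\<close>, generated from the root downwards. Derivability of all premises lets such a
  proof be completed; \<open>target\<close> asks for none, so \<open>bot_atom\<close> counts as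
  needed once it is in \<open>R\<close>.\<close>

inductive needed ::
  "('p, 'v, 'c) datalog_rule set \<Rightarrow> ('p, 'v, 'c) atom set \<Rightarrow> ('p, 'v, 'c) atom set \<Rightarrow>
   ('p, 'v, 'c) atom \<Rightarrow> bool" for P A R where
  target: "\<gamma> \<in> R \<Longrightarrow> needed P A R \<gamma>"
| premise: "needed P A R \<gamma> \<Longrightarrow> \<rho> \<in> P \<Longrightarrow> consequence \<gamma> \<rho> \<gamma>s \<Longrightarrow>
    (\<And>\<delta>. \<delta> \<in> set \<gamma>s \<Longrightarrow> derivable P A \<delta>) \<Longrightarrow> \<delta> \<in> set \<gamma>s \<Longrightarrow> needed P A R \<delta>"

text \<open>A proof of a needed fact can be grafted into a proof of a fact of \<open>R\<close>: each
  induction step adds one node towards the root, which is why \<open>t\<close> stays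
  arbitrary.\<close>

lemma tree_rules_needed:
  assumes "needed P A R \<gamma>" "is_proof P A \<gamma> t"
  shows "tree_rules t \<subseteq> (\<Union>\<gamma>\<in>R. fact_support P A \<gamma>)"
  using assms
proof (induction arbitrary: t)
  case (target \<gamma>)
  then show ?case
    by (auto simp: fact_support_def)
next
  case (premise \<gamma> \<rho> \<gamma>s \<delta>)
  from premise.hyps(4) obtain tr where tr: "\<And>\<delta>. \<delta> \<in> set \<gamma>s \<Longrightarrow> is_proof P A \<delta> (tr \<delta>)"
    unfolding derivable_def by metis
  \<comment> \<open>Subproofs are indexed by facts: the update places \<open>t\<close> at every
    occurrence of \<open>\<delta>\<close> among the premises, and the siblings keep some chosen
    proof.\<close>
  let ?tr = "tr(\<delta> := t)"
  have "is_proof P A \<gamma> (Node \<gamma> \<rho> (map ?tr \<gamma>s))"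
    using premise.hyps premise.prems tr by (intro is_proof_Node) auto
  from premise.IH[OF this] \<open>\<delta> \<in> set \<gamma>s\<close> show ?case
    by auto
qed

section \<open>Ground instances as datalog consequences\<close>

lemma subst_trm_ground: "trm_vars t = {} \<Longrightarrow> subst_trm \<sigma> t = t"
  by (cases t) auto

lemma subst_atom_ground: "atom_vars a = {} \<Longrightarrow> subst_atom \<sigma> a = a"
  by (cases a) (auto simp: subst_atom_def atom_vars_def subst_trm_ground map_idI)

lemma atom_vars_subst_const:
  fixes a :: "('p, 'v, 'c) atom"
  shows "atom_vars (subst_atom (\<lambda>x. Const (\<kappa> x)) a) = {}"
proof -
  have "trm_vars (subst_trm (\<lambda>x. Const (\<kappa> x)) t) = {}" for t :: "('v, 'c) trm"
    by (cases t) auto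
  then show ?thesis
    by (auto simp: subst_atom_def atom_vars_def)
qed

lemma wf_atom_subst: "wf_atom (subst_atom \<sigma> a) \<longleftrightarrow> wf_atom a"
  by (simp add: wf_atom_def subst_atom_def)

lemma subst_trm_cong: "(\<And>x. x \<in> trm_vars t \<Longrightarrow> \<sigma> x = \<tau> x) \<Longrightarrow> subst_trm \<sigma> t = subst_trm \<tau> t"
  by (cases t) auto

lemma subst_atom_cong:
  "(\<And>x. x \<in> atom_vars a \<Longrightarrow> \<sigma> x = \<tau> x) \<Longrightarrow> subst_atom \<sigma> a = subst_atom \<tau> a"
  by (auto simp: subst_atom_def atom_vars_def intro!: subst_trm_cong)

lemma subst_trm_eqD: "subst_trm \<sigma> t = subst_trm \<tau> t \<Longrightarrow> x \<in> trm_vars t \<Longrightarrow> \<sigma> x = \<tau> x"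
  by (cases t) auto

lemma subst_atom_eqD:
  assumes "subst_atom \<sigma> a = subst_atom \<tau> a" "x \<in> atom_vars a"
  shows "\<sigma> x = \<tau> x"
  using assms by (auto simp: subst_atom_def atom_vars_def dest: subst_trm_eqD)

text \<open>Matching a body against its own ground instance has a most general unifier: the
  instantiation on body variables, the identity elsewhere. Safety of \<open>h\<close> makes it
  produce the same head.\<close>

lemma consequence_instance:
  assumes "wf_atom h" "atom_vars h \<subseteq> (\<Union>a\<in>set b. atom_vars a)"
  shows "consequence (subst_atom (\<lambda>x. Const (\<kappa> x)) h) (b, h) (map (subst_atom (\<lambda>x. Const (\<kappa> x))) b)"
proof -
  let ?s = "\<lambda>x. Const (\<kappa> x)"
  let ?V = "\<Union>a\<in>set b. atom_vars a"
  let ?E = "set (zip (map (subst_atom ?s) b) b)"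
  define \<sigma> where "\<sigma> x = (if x \<in> ?V then ?s x else Var x)" for x
  have E: "?E = (\<lambda>a. (subst_atom ?s a, a)) ` set b"
    by (simp add: zip_map1 zip_same_conv_map image_image)
  have unif: "is_unifier \<tau> ?E \<longleftrightarrow> (\<forall>a\<in>set b. subst_atom ?s a = subst_atom \<tau> a)" for \<tau>
    unfolding is_unifier_def E by (auto simp: subst_atom_ground[OF atom_vars_subst_const])
  have "is_unifier \<sigma> ?E"
    unfolding unif by (auto simp: \<sigma>_def intro!: subst_atom_cong)
  \<comment> \<open>Any unifier agrees with \<open>\<sigma>\<close> on the body variables, so it
    factors through \<open>\<sigma>\<close> with itself as second substitution.\<close>
  moreover have "\<tau> = subst_trm \<tau> \<circ> \<sigma>" if "is_unifier \<tau> ?E" for \<tau>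
  proof
    fix x
    show "\<tau> x = (subst_trm \<tau> \<circ> \<sigma>) x"
      using that subst_atom_eqD[of ?s _ \<tau> x] unfolding unif \<sigma>_def by fastforce
  qed
  ultimately have "is_mgu \<sigma> ?E"
    unfolding is_mgu_def by blast
  moreover have "subst_atom ?s h = subst_atom \<sigma> h"
    using assms(2) by (intro subst_atom_cong) (auto simp: \<sigma>_def)
  moreover have "is_fact (subst_atom ?s h)"
    using assms(1) by (simp add: is_fact_def wf_atom_subst atom_vars_subst_const)
  ultimately show ?thesis
    unfolding consequence_def by auto
qed


section \<open>The product interpretation\<close>

context
  fixes T :: "('p, 'v, 'c) rule set" and \<chi> :: "('p, 'v, 'c) setting"
begin

abbreviation drv :: "('p, 'v, 'c) atom \<Rightarrow> bool" where
  "drv \<equiv> derivable (program T \<chi>) (initial_facts \<chi>)"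

abbreviation ndd :: "('p, 'v, 'c) atom \<Rightarrow> bool" where
  "ndd \<equiv> needed (program T \<chi>) (initial_facts \<chi>) (relevant_facts \<chi>)"

text \<open>The functions \<open>f\<close> and \<open>g\<close> are the projections to the element and to the constant.\<close>

definition product_interp ::
  "('p, 'c, 'd) interp \<Rightarrow> ('d \<Rightarrow> 'd) \<Rightarrow> ('d \<Rightarrow> 'c) \<Rightarrow> ('p, 'c, 'd) interp" where
  "product_interp I f g =
     \<lparr> domain = UNIV, const_interp = (\<lambda>_. undefined),
       pred_interp = (\<lambda>p. {ds. drv (Atom p (map (Const \<circ> g) ds)) \<and>
          (ndd (Atom p (map (Const \<circ> g) ds)) \<longrightarrow> map f ds \<in> pred_interp I p)}) \<rparr>"

text \<open>The condition defining the predicates extends to the logical atoms: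
  \<open>bot_atom\<close> is a target, hence needed, and false in \<open>I\<close>;
  \<open>top_atom\<close> is derivable and true in \<open>I\<close>. Without constants all arguments
  are variables, so both projections commute with evaluation.\<close>

lemma holds_product_interp:
  fixes I :: "('p, 'c, 'd) interp"
  assumes "wf_atom a" "atom_constants a = {}" "bot_atom \<in> relevant_facts \<chi>"
  shows "holds (product_interp I f g) \<nu> a \<longleftrightarrow>
    drv (subst_atom (\<lambda>x. Const (g (\<nu> x))) a) \<and>
    (ndd (subst_atom (\<lambda>x. Const (g (\<nu> x))) a) \<longrightarrow> holds I (f \<circ> \<nu>) a)"
proof -
  obtain p ts where a: "a = Atom p ts"
    by (cases a)
  show ?thesis
  proof (cases p)
    case (Sym q n)
    have const: "trm_constants t = {}" if "t \<in> set ts" for t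
      using assms(2) that by (auto simp: a atom_constants_def)
    have "map (Const \<circ> g) (map (trm_val J \<nu>) ts) = map (subst_trm (\<lambda>x. Const (g (\<nu> x)))) ts"
      "map f (map (trm_val J \<nu>) ts) = map (trm_val I (f \<circ> \<nu>)) ts" for J :: "('p, 'c, 'd) interp"
    proof -
      have "Const (g (trm_val J \<nu> t)) = subst_trm (\<lambda>x. Const (g (\<nu> x))) t \<and>
          f (trm_val J \<nu> t) = trm_val I (f \<circ> \<nu>) t" if "t \<in> set ts" for t
        using const[OF that] by (cases t) auto
      then show "map (Const \<circ> g) (map (trm_val J \<nu>) ts) = map (subst_trm (\<lambda>x. Const (g (\<nu> x)))) ts"
        "map f (map (trm_val J \<nu>) ts) = map (trm_val I (f \<circ> \<nu>)) ts"
        by auto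
    qed
    then show ?thesis
      unfolding a subst_atom_def using Sym by (simp add: product_interp_def del: map_map)
  qed (use assms in \<open>auto simp: a wf_atom_def subst_atom_def derivable_top intro: needed.target\<close>)
qed

text \<open>The instantiated datalog rule is the root step of a proof of its head. If that head is
  needed, grafting puts the rule into the support, hence \<open>r\<close> into the module, and
  \<open>premise\<close> passes neededness down to the body.\<close>

lemma corresponding_instance:
  assumes r: "r \<in> T" "wf_rule r" and h: "(body r, h) \<in> corresponding (theta \<chi>) r"
    and vars: "wf_atom h" "atom_vars h \<subseteq> body_vars r"
    and drv: "\<And>a. a \<in> set (body r) \<Longrightarrow> drv (subst_atom (\<lambda>x. Const (\<kappa> x)) a)"
  shows "drv (subst_atom (\<lambda>x. Const (\<kappa> x)) h)"
    and "ndd (subst_atom (\<lambda>x. Const (\<kappa> x)) h) \<Longrightarrow>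
      r \<in> module_of T \<chi> \<and> (\<forall>a\<in>set (body r). ndd (subst_atom (\<lambda>x. Const (\<kappa> x)) a))"
proof -
  let ?s = "subst_atom (\<lambda>x. Const (\<kappa> x))"
  have P: "(body r, h) \<in> program T \<chi>"
    using r(1) h by (auto simp: program_def)
  have cons: "consequence (?s h) (body r, h) (map ?s (body r))"
    using vars by (intro consequence_instance) (auto simp: body_vars_def)
  have drv': "drv \<delta>" if "\<delta> \<in> set (map ?s (body r))" for \<delta>
    using that drv by auto
  then obtain tr where
    tr: "\<And>\<delta>. \<delta> \<in> set (map ?s (body r)) \<Longrightarrow> is_proof (program T \<chi>) (initial_facts \<chi>) \<delta> (tr \<delta>)"
    unfolding derivable_def by metis
  have "map ?s (body r) \<noteq> []"
    using r(2) by (simp add: wf_rule_def)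
  note proof_h = is_proof_Node[OF this P cons tr]
  then show "drv (?s h)"
    unfolding derivable_def by blast
  assume ndd: "ndd (?s h)"
  from tree_rules_needed[OF ndd proof_h] have "(body r, h) \<in> support T \<chi>"
    by (auto simp: support_def)
  with r(1) h have "r \<in> module_of T \<chi>"
    by (auto simp: module_of_def)
  moreover have "ndd (?s a)" if "a \<in> set (body r)" for a
    by (rule needed.premise[OF ndd P cons drv']) (use that in auto)
  ultimately show "r \<in> module_of T \<chi> \<and> (\<forall>a\<in>set (body r). ndd (?s a))"
    by blast
qed

text \<open>All head instances are derivable, so only needed head atoms constrain \<open>I\<close>.
  Either some disjunct has none, or a needed head puts \<open>r\<close> into the module and makes
  the body needed; then the body holds in \<open>I\<close>, and a disjunct true there lifts
  back.\<close>

lemma product_interp_satisfies: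
  fixes I :: "('p, 'c, 'd) interp"
  assumes r: "r \<in> T" "wf_rule r" and const: "constants_of T = {}"
    and bot: "bot_atom \<in> relevant_facts \<chi>" and dom: "exs r \<subseteq> dom (theta \<chi>)"
    and I: "\<And>r. r \<in> module_of T \<chi> \<Longrightarrow> satisfies I r"
    and f: "range f \<subseteq> domain I"
    and fg: "\<And>d c. d \<in> domain I \<Longrightarrow> c \<in> ran (theta \<chi>) \<Longrightarrow> \<exists>z. f z = d \<and> g z = c"
  shows "satisfies (product_interp I f g) r"
  unfolding satisfies_def
proof (intro allI impI)
  let ?J = "product_interp I f g"
  fix \<nu> :: "'v \<Rightarrow> 'd"
  assume "range \<nu> \<subseteq> domain ?J" and body: "\<forall>a\<in>set (body r). holds ?J \<nu> a"
  define \<kappa> where "\<kappa> x = g (\<nu> x)" for x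
  \<comment> \<open>Existential variables take their constant from \<open>theta \<chi>\<close>, so
    that \<open>?s'\<close> of a head atom is the \<open>?s\<close> instance of the corresponding
    datalog head.\<close>
  define \<kappa>' where "\<kappa>' x = (if x \<in> exs r then the (theta \<chi> x) else \<kappa> x)" for x
  let ?s = "subst_atom (\<lambda>x. Const (\<kappa> x))"
  let ?s' = "subst_atom (\<lambda>x. Const (\<kappa>' x))"
  let ?\<theta> = "subst_atom (subst_of (theta \<chi> |` exs r))"
  have wf: "wf_atom a \<and> atom_constants a = {}" if "a \<in> set (body r) \<or> a \<in> head_atoms r" for a
    using that r const by (auto simp: wf_rule_def rule_atoms_def constants_of_def)
  have body': "drv (?s a) \<and> (ndd (?s a) \<longrightarrow> holds I (f \<circ> \<nu>) a)" if "a \<in> set (body r)" for a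
    using that body wf[of a] holds_product_interp[of a I f g \<nu>] bot by (simp add: \<kappa>_def)
  have theta: "theta \<chi> x = Some (the (theta \<chi> x))" if "x \<in> exs r" for x
    using that dom by auto
  have s': "?s (?\<theta> a) = ?s' a" for a :: "('p, 'v, 'c) atom"
  proof -
    have "subst_trm (\<lambda>x. Const (\<kappa> x)) (subst_trm (subst_of (theta \<chi> |` exs r)) t) =
        subst_trm (\<lambda>x. Const (\<kappa>' x)) t" for t
    proof (cases t)
      case (Var x)
      then show ?thesis
        using theta[of x]
        by (cases "x \<in> exs r")
          (auto simp: subst_of_def \<kappa>'_def restrict_map_def split: option.splits)
    qed simp
    then show ?thesis
      by (auto simp: subst_atom_def)
  qed
  have vars: "wf_atom (?\<theta> a) \<and> atom_vars (?\<theta> a) \<subseteq> body_vars r" if "a \<in> head_atoms r" for a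
  proof
    show "wf_atom (?\<theta> a)"
      using wf that by (simp add: wf_atom_subst)
    have "atom_vars a \<subseteq> body_vars r \<union> exs r"
      using that r(2) by (auto simp: wf_rule_def head_vars_def)
    moreover have "trm_vars (subst_trm (subst_of (theta \<chi> |` exs r)) t) \<subseteq> trm_vars t - exs r" for t
    proof (cases t)
      case (Var x)
      then show ?thesis
        using theta[of x]
        by (cases "x \<in> exs r") (auto simp: subst_of_def restrict_map_def split: option.splits)
    qed simp
    ultimately show "atom_vars (?\<theta> a) \<subseteq> body_vars r"
      by (fastforce simp: atom_vars_def subst_atom_def)
  qed
  have corr: "(body r, ?\<theta> a) \<in> corresponding (theta \<chi>) r" if "a \<in> head_atoms r" for a
    using that by (auto simp: corresponding_def head_atoms_def)
  have drv_head: "drv (?s' a)" if "a \<in> head_atoms r" for a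
    using corresponding_instance(1)[OF r corr[OF that], of \<kappa>] vars[OF that] body' s' by auto
  \<comment> \<open>An assignment in \<open>I\<close> lifts when each existential variable \<open>y\<close> is paired with its constant.\<close>
  have lift: "\<exists>\<mu>. range \<mu> \<subseteq> domain ?J \<and> (\<forall>x. x \<notin> exs r \<longrightarrow> \<mu> x = \<nu> x) \<and>
      (\<exists>\<psi>\<in>set (heads r). \<forall>a\<in>set \<psi>. holds ?J \<mu> a)"
    if \<mu>: "range \<mu>\<^sub>1 \<subseteq> domain I" "\<forall>x. x \<notin> exs r \<longrightarrow> \<mu>\<^sub>1 x = f (\<nu> x)"
      and \<psi>: "\<psi> \<in> set (heads r)" "\<And>a. a \<in> set \<psi> \<Longrightarrow> ndd (?s' a) \<Longrightarrow> holds I \<mu>\<^sub>1 a" for \<mu>\<^sub>1 \<psi>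
  proof -
    have "\<exists>z. (x \<notin> exs r \<longrightarrow> z = \<nu> x) \<and> f z = \<mu>\<^sub>1 x \<and> g z = \<kappa>' x" for x
    proof (cases "x \<in> exs r")
      case True
      then have "the (theta \<chi> x) \<in> ran (theta \<chi>)"
        using theta by (auto intro: ranI)
      moreover have "\<mu>\<^sub>1 x \<in> domain I"
        using \<mu>(1) by auto
      ultimately show ?thesis
        using fg[of "\<mu>\<^sub>1 x"] True by (auto simp: \<kappa>'_def)
    next
      case False
      then show ?thesis
        using \<mu>(2) by (auto simp: \<kappa>'_def \<kappa>_def)
    qed
    then obtain \<mu> where \<mu>': "\<And>x. (x \<notin> exs r \<longrightarrow> \<mu> x = \<nu> x) \<and> f (\<mu> x) = \<mu>\<^sub>1 x \<and> g (\<mu> x) = \<kappa>' x"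
      by metis
    then have "f \<circ> \<mu> = \<mu>\<^sub>1"
      by auto
    have "holds ?J \<mu> a" if "a \<in> set \<psi>" for a
    proof -
      have a: "a \<in> head_atoms r"
        using that \<psi>(1) by (auto simp: head_atoms_def)
      then show ?thesis
        using holds_product_interp[of a I f g \<mu>] wf[of a] bot \<psi>(2)[OF that] drv_head[OF a] \<mu>'
          \<open>f \<circ> \<mu> = \<mu>\<^sub>1\<close> by simp
    qed
    moreover have "range \<mu> \<subseteq> domain ?J"
      by (simp add: product_interp_def)
    ultimately show ?thesis
      using \<mu>' \<psi>(1) by blast
  qed
  show "\<exists>\<mu>. range \<mu> \<subseteq> domain ?J \<and> (\<forall>x. x \<notin> exs r \<longrightarrow> \<mu> x = \<nu> x) \<and>
      (\<exists>\<psi>\<in>set (heads r). \<forall>a\<in>set \<psi>. holds ?J \<mu> a)"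
  proof (cases "\<exists>\<psi>\<in>set (heads r). \<forall>a\<in>set \<psi>. \<not> ndd (?s' a)")
    case True
    then obtain \<psi> where "\<psi> \<in> set (heads r)" "\<forall>a\<in>set \<psi>. \<not> ndd (?s' a)"
      by blast
    \<comment> \<open>Derivability alone makes the atoms of \<open>\<psi>\<close> true, whatever
      elements the existential variables receive; \<open>f \<circ> \<nu>\<close> supplies some from
      the domain of \<open>I\<close>.\<close>
    then show ?thesis
      using f by (intro lift[of "f \<circ> \<nu>" \<psi>]) auto
  next
    case False
    \<comment> \<open>One needed datalog head is enough for the module: falsehood if there are no
      disjuncts, otherwise a needed atom of the first disjunct.\<close>
    have "\<exists>h. (body r, h) \<in> corresponding (theta \<chi>) r \<and> wf_atom h \<and> atom_vars h \<subseteq> body_vars r \<and>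
        ndd (?s h)"
    proof (cases "heads r")
      case Nil
      then show ?thesis
        using bot
        by (intro exI[of _ bot_atom])
          (auto simp: corresponding_def wf_atom_def atom_vars_def subst_atom_def intro: needed.target)
    next
      case (Cons \<psi> \<psi>s)
      with False obtain a where "a \<in> head_atoms r" "ndd (?s' a)"
        by (auto simp: head_atoms_def)
      then show ?thesis
        using vars corr s' by (intro exI[of _ "?\<theta> a"]) auto
    qed
    then have "r \<in> module_of T \<chi> \<and> (\<forall>a\<in>set (body r). ndd (?s a))"
      using corresponding_instance(2)[OF r] body' by blast
    then have "satisfies I r" "\<forall>a\<in>set (body r). holds I (f \<circ> \<nu>) a"
      using I body' by blast+
    moreover have "range (f \<circ> \<nu>) \<subseteq> domain I"
      using f by auto
    ultimately obtain \<mu>\<^sub>1 \<psi> where "range \<mu>\<^sub>1 \<subseteq> domain I" "\<forall>x. x \<notin> exs r \<longrightarrow> \<mu>\<^sub>1 x = (f \<circ> \<nu>) x"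
      "\<psi> \<in> set (heads r)" "\<forall>a\<in>set \<psi>. holds I \<mu>\<^sub>1 a"
      unfolding satisfies_def by blast
    then show ?thesis
      by (intro lift) auto
  qed
qed

end

section \<open>Projections from an infinite type onto pairs\<close>

text \<open>\<open>entails\<close> fixes the domain type, so pairs must be encoded in
  \<open>'d\<close> itself. As \<open>'d\<close> is infinite and \<open>C\<close> finite,
  cardinality gives a surjection onto the pairs; \<open>f\<close> and \<open>g\<close> are its
  components.\<close>

lemma ex_projections:
  includes cardinal_syntax
  fixes D :: "'d set" and C :: "'c set"
  assumes "infinite (UNIV :: 'd set)" "finite C" "D \<noteq> {}"
  shows "\<exists>(f :: 'd \<Rightarrow> 'd) g. range f \<subseteq> D \<and> (\<forall>d\<in>D. \<forall>c\<in>C. \<exists>z. f z = d \<and> g z = c)"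
proof -
  \<comment> \<open>Adding \<open>undefined\<close> keeps the second factor nonempty even for empty
    \<open>C\<close>, as a surjection onto the product requires.\<close>
  let ?S = "D \<times> insert undefined C"
  have "|insert undefined C| \<le>o |UNIV :: 'd set|"
    using assms
    by (intro ordLess_imp_ordLeq finite_ordLess_infinite card_of_Well_order)
      (simp_all add: Field_card_of)
  then have "|(UNIV :: 'd set) \<times> insert undefined C| =o |UNIV :: 'd set|"
    using assms(1) by (intro card_of_Times_infinite[THEN conjunct1]) auto
  moreover have "|?S| \<le>o |(UNIV :: 'd set) \<times> insert undefined C|"
    by (intro card_of_mono1) auto
  ultimately have "|?S| \<le>o |UNIV :: 'd set|"
    by (rule ordLeq_ordIso_trans[rotated])
  then obtain p :: "'d \<Rightarrow> 'd \<times> 'c" where p: "range p = ?S"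
    using card_of_ordLeq2[of ?S "UNIV :: 'd set"] assms(3) by auto
  have "range (fst \<circ> p) \<subseteq> D"
    unfolding image_comp[symmetric] p by auto
  moreover have "\<exists>z. (fst \<circ> p) z = d \<and> (snd \<circ> p) z = c" if "d \<in> D" "c \<in> C" for d c
  proof -
    have "(d, c) \<in> range p"
      using p that by auto
    then obtain z where "p z = (d, c)"
      by (auto simp: image_iff)
    then show ?thesis
      by (intro exI[of _ z]) simp
  qed
  ultimately show ?thesis
    by (intro exI[of _ "fst \<circ> p"] exI[of _ "snd \<circ> p"]) auto
qed

section \<open>Subsumptions in the TBox and in the module\<close>

lemma satisfies_subsumption:
  fixes I :: "('p, 'c, 'd) interp" and xs :: "'v list"
  shows "satisfies I (subsumption A B xs) \<longleftrightarrow>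
     (\<forall>\<nu>. range \<nu> \<subseteq> domain I \<longrightarrow> holds I \<nu> (apply_pred A (map Var xs)) \<longrightarrow>
        holds I \<nu> (apply_pred B (map Var xs)))"
proof -
  have "(\<exists>\<mu>. range \<mu> \<subseteq> domain I \<and> (\<forall>x. \<mu> x = \<nu> x) \<and> holds I \<mu> a) \<longleftrightarrow>
      range \<nu> \<subseteq> domain I \<and> holds I \<nu> a"
    for \<nu> :: "'v \<Rightarrow> 'd" and a :: "('p, 'v, 'c) atom"
    by (metis ext)
  then show ?thesis
    by (auto simp: satisfies_def subsumption_def)
qed

text \<open>The subsumption holds in the product interpretation, a model of \<open>T\<close>.
  Evaluating it where the values of \<open>xs\<close> are paired with the constants of
  \<open>A\<close> carries it back to \<open>I\<close>.\<close>

lemma module_entails_subsumption: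
  fixes T :: "('p, 'v, 'c) rule set"
  assumes T: "is_tbox T" "constants_of T = {}" and "\<Sigma> \<subseteq> sig T"
    and inf: "infinite (UNIV :: 'd set)"
    and A: "A \<in> \<Sigma>" "has_arity A (length xs)" and B: "B \<in> sig T" "has_arity B (length xs)"
    and AB: "A \<noteq> B" "A \<noteq> Bot" and xs: "distinct xs"
    and ent: "entails TYPE('d) T (subsumption A B xs)"
  shows "entails TYPE('d) (module_of T (chi_c T \<Sigma> cv cp)) (subsumption A B xs)"
  unfolding entails_def satisfies_subsumption
proof (intro allI impI)
  let ?\<chi> = "chi_c T \<Sigma> cv cp"
  fix I :: "('p, 'c, 'd) interp" and \<nu> :: "'v \<Rightarrow> 'd"
  assume I: "is_interp I" "\<forall>r\<in>module_of T ?\<chi>. satisfies I r"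
    and \<nu>: "range \<nu> \<subseteq> domain I" "holds I \<nu> (apply_pred A (map Var xs))"
  have arity: "arity A = length xs"
    using A AB by (simp add: has_arity_def)
  have not_Top: "A \<noteq> Top" "B \<noteq> Top"
    using A B \<open>\<Sigma> \<subseteq> sig T\<close> by (auto simp: sig_def)
  have fin: "finite (exvars T)"
    using T(1) by (auto simp: is_tbox_def wf_rule_def exvars_def)
  have dom: "dom (theta ?\<chi>) = exvars T" and ran: "ran (theta ?\<chi>) = cv ` exvars T"
    by (auto simp: chi_c_def dom_def ran_def split: if_splits)
  \<comment> \<open>Second components to be paired with all elements of \<open>I\<close>: the
    constants of existential variables lift witnesses, those of \<open>A\<close> lift
    \<open>\<nu>\<close>.\<close>
  let ?C = "cv ` exvars T \<union> cp A ` {1..arity A}"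
  obtain f :: "'d \<Rightarrow> 'd" and g where f: "range f \<subseteq> domain I"
    and fg: "\<And>d c. d \<in> domain I \<Longrightarrow> c \<in> ?C \<Longrightarrow> \<exists>z. f z = d \<and> g z = c"
  proof -
    have "finite ?C" "domain I \<noteq> {}"
      using fin I(1) by (simp_all add: is_interp_def)
    from ex_projections[OF inf this] that show ?thesis
      by metis
  qed
  \<comment> \<open>Falsehood fits every arity and differs from \<open>A\<close>, so it is among the
    right-hand sides tested for \<open>A\<close>.\<close>
  have bot: "bot_atom \<in> relevant_facts ?\<chi>"
    using A AB by (force simp: chi_c_def apply_pred_def has_arity_def sig_def)
  let ?J = "product_interp T ?\<chi> I f g"
  have "satisfies ?J r" if "r \<in> T" for r
    using that T f fg bot dom ran I(2)
    by (intro product_interp_satisfies) (auto simp: is_tbox_def exvars_def)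
  moreover have "is_interp ?J"
    by (simp add: is_interp_def product_interp_def)
  ultimately have J: "satisfies ?J (subsumption A B xs)"
    using ent by (simp add: entails_def)

  \<comment> \<open>Distinctness of \<open>xs\<close> lets the index be recovered from the variable.
    List positions start at 0 and the constants of \<open>A\<close> at 1, hence
    \<open>Suc i\<close>.\<close>
  have "\<exists>\<mu>. \<forall>i < length xs. f (\<mu> (xs ! i)) = \<nu> (xs ! i) \<and> g (\<mu> (xs ! i)) = cp A (Suc i)"
  proof -
    have "\<forall>i. \<exists>z. i < length xs \<longrightarrow> f z = \<nu> (xs ! i) \<and> g z = cp A (Suc i)"
      using fg[of "\<nu> (xs ! i)" "cp A (Suc i)" for i] \<nu>(1) arity by (auto simp: image_subset_iff)
    then obtain z where z: "\<And>i. i < length xs \<Longrightarrow> f (z i) = \<nu> (xs ! i) \<and> g (z i) = cp A (Suc i)"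
      by metis
    have "z (the_inv_into {..<length xs} ((!) xs) (xs ! i)) = z i" if "i < length xs" for i
      using that xs by (simp add: the_inv_into_f_f inj_on_nth)
    with z show ?thesis
      by (intro exI[of _ "\<lambda>x. z (the_inv_into {..<length xs} ((!) xs) x)"]) auto
  qed
  then obtain \<mu> where
    \<mu>: "\<And>i. i < length xs \<Longrightarrow> f (\<mu> (xs ! i)) = \<nu> (xs ! i) \<and> g (\<mu> (xs ! i)) = cp A (Suc i)"
    by blast
  have f\<mu>: "map f (map \<mu> xs) = map \<nu> xs"
    by (rule nth_equalityI) (use \<mu> in auto)
  have g\<mu>: "map (Const \<circ> g) (map \<mu> xs) = (pred_constants cp A :: ('v, 'c) trm list)"
    using \<mu> arity by (auto simp: pred_constants_def simp del: upt_Suc intro!: nth_equalityI)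
  have holds_J: "holds ?J \<mu> (Atom p (map Var xs)) \<longleftrightarrow>
      derivable (program T ?\<chi>) (initial_facts ?\<chi>) (Atom p (pred_constants cp A)) \<and>
      (needed (program T ?\<chi>) (initial_facts ?\<chi>) (relevant_facts ?\<chi>) (Atom p (pred_constants cp A)) \<longrightarrow>
        map \<nu> xs \<in> pred_interp I p)" if "p \<noteq> Bot" "p \<noteq> Top" for p
  proof -
    have "map (trm_val ?J \<mu>) (map Var xs) = map \<mu> xs"
      by simp
    with that show ?thesis
      unfolding f\<mu>[symmetric] g\<mu>[symmetric]
      by (cases p) (simp_all add: product_interp_def comp_def)
  qed
  have holds_I: "holds I \<nu> (Atom p (map Var xs)) \<longleftrightarrow> map \<nu> xs \<in> pred_interp I p"
    if "p \<noteq> Bot" "p \<noteq> Top" for p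
    using that by (cases p) (auto simp: comp_def)
  \<comment> \<open>An initial fact is derivable, and the condition for needed facts is met because
    \<open>A\<close> already holds in \<open>I\<close> under \<open>\<nu>\<close>.\<close>
  have "Atom A (pred_constants cp A) \<in> initial_facts ?\<chi>"
    using A(1) by (auto simp: chi_c_def)
  then have "holds ?J \<mu> (apply_pred A (map Var xs))"
    using \<nu>(2) AB not_Top holds_J holds_I by (auto simp: apply_pred_def derivable_fact)
  moreover have "range \<mu> \<subseteq> domain ?J"
    by (simp add: product_interp_def)
  ultimately have JB: "holds ?J \<mu> (apply_pred B (map Var xs))"
    using J by (simp add: satisfies_subsumption)
  show "holds I \<nu> (apply_pred B (map Var xs))"
  proof (cases "B = Bot")
    case True
    \<comment> \<open>Falsehood holds in no interpretation, so \<open>JB\<close> is contradictory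
      here.\<close>
    then show ?thesis
      using JB by (simp add: apply_pred_def)
  next
    case False
    \<comment> \<open>Being relevant, this fact is needed, so its truth in \<open>?J\<close> forces
      truth of \<open>B\<close> in \<open>I\<close>.\<close>
    have "apply_pred B (pred_constants cp A) \<in> relevant_facts ?\<chi>"
      using A(1) B AB arity unfolding chi_c_def setting.simps
      by (intro CollectI exI[of _ A] exI[of _ B]) simp
    then show ?thesis
      using JB False not_Top holds_J[of B] holds_I[of B]
      by (simp add: apply_pred_def needed.target)
  qed
qed

theorem theorem13:
  fixes T :: "('p, 'v, 'c) rule set"
    and \<Sigma> :: "'p pred set"
    and cv :: "'v \<Rightarrow> 'c"
    and cp :: "'p pred \<Rightarrow> nat \<Rightarrow> 'c"
  assumes "is_tbox T"
    and "constants_of T = {}"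
    and "no_shared_exvars T"
    and "Bot \<in> \<Sigma>"
    and "\<Sigma> \<subseteq> sig T"
    and "fresh_constants T \<Sigma> cv cp"
    and "infinite (UNIV :: 'd set)"
  shows "class_inseparable TYPE('d) \<Sigma> (module_of T (chi_c T \<Sigma> cv cp)) T"
  unfolding class_inseparable_def
proof (intro ballI allI impI)
  let ?M = "module_of T (chi_c T \<Sigma> cv cp)"
  fix A B and xs :: "'v list"
  assume A: "A \<in> \<Sigma>" "has_arity A (length xs)"
    and B: "B \<in> sig (T \<union> ?M)" "has_arity B (length xs)" and xs: "distinct xs"
  have "?M \<subseteq> T"
    by (auto simp: module_of_def)
  then have "B \<in> sig T"
    using B(1) by (simp add: Un_absorb2)
  show "entails TYPE('d) ?M (subsumption A B xs) \<longleftrightarrow> entails TYPE('d) T (subsumption A B xs)"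
  proof
    assume "entails TYPE('d) ?M (subsumption A B xs)"
    with \<open>?M \<subseteq> T\<close> show "entails TYPE('d) T (subsumption A B xs)"
      unfolding entails_def by blast
  next
    assume ent: "entails TYPE('d) T (subsumption A B xs)"
    show "entails TYPE('d) ?M (subsumption A B xs)"
    \<comment> \<open>These two cases are tautologies and are split off because
      \<open>A \<noteq> B\<close> makes the fact for \<open>B\<close> relevant and
      \<open>A \<noteq> Bot\<close> makes \<open>bot_atom\<close> relevant.\<close>
    proof (cases "A = B \<or> A = Bot")
      case True
      then show ?thesis
        by (auto simp: entails_def satisfies_subsumption apply_pred_def)
    next
      case False
      with assms A B \<open>B \<in> sig T\<close> xs ent show ?thesis
        by (intro module_entails_subsumption) auto
    qed
  qed
qed

end
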